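(* Let $r,s\ge 1$ be integers and let $G=K_{r,s}$ be the complete bipartite graph with parts of sizes $r$ and $s$, with vertices $v_1,\dots,v_{r+s}$. Then every vertex $v_i$ of $G$ satisfies $$\mathcal{E}_S(v_i)=\frac{2(r+s-1)}{r+s}.$$
   Context: All graphs are finite, simple and undirected. The Seidel matrix of a graph $G$ with vertex set $\{v_1,\dots,v_n\}$ is the real symmetric $n\times n$ matrix $S(G)=[s_{ij}]$ with $s_{ii}=0$, and for $i\neq j$, $s_{ij}=-1$ if $v_i$ and $v_j$ are adjacent and $s_{ij}=1$ otherwise. For a real symmetric matrix $S$, $|S|=(S^2)^{1/2}$ is the positive semidefinite square root of $S^2$. The vertex Seidel energy of $v_i$ is $\mathcal{E}_S(v_i)=|S(G)|_{ii}$, the $i$-th diagonal entry of $|S(G)|$. *)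

theory Defs
  imports "Graph_Theory.Graph_Theory" "Jordan_Normal_Form.Matrix"
begin

text \<open>
  Finite simple undirected graphs are the symmetric digraphs of the locale \<^locale>\<open>graph\<close>
  (finite, loopless, without parallel arcs); two vertices are adjacent iff they are joined
  by an arc in either, equivalently both, directions. The list \<open>vs\<close> enumerates the vertices as
  \<open>v\<^sub>1, \<dots>, v\<^sub>n\<close>; list and matrix indices start at 0.
\<close>

definition vertex_enumeration :: "('a, 'b) pre_digraph \<Rightarrow> 'a list \<Rightarrow> bool" where
  "vertex_enumeration G vs \<longleftrightarrow> distinct vs \<and> set vs = verts G"

definition seidel_matrix :: "('a, 'b) pre_digraph \<Rightarrow> 'a list \<Rightarrow> real mat" where
  "seidel_matrix G vs = mat (length vs) (length vs)
     (\<lambda>(i, j). if i = j then 0 else if vs ! i \<rightarrow>\<^bsub>G\<^esub> vs ! j then -1 else 1)"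

definition psd_mat :: "real mat \<Rightarrow> bool" where
  "psd_mat A \<longleftrightarrow> square_mat A \<and> transpose_mat A = A \<and>
     (\<forall>x \<in> carrier_vec (dim_row A). 0 \<le> x \<bullet> (A *\<^sub>v x))"

text \<open>
  A positive semidefinite matrix has exactly one positive semidefinite square root, so the
  description below is proper on such matrices; elsewhere the value is irrelevant.
\<close>

definition psd_sqrt :: "real mat \<Rightarrow> real mat" where
  "psd_sqrt A = (THE B. B \<in> carrier_mat (dim_row A) (dim_row A) \<and> psd_mat B \<and> B * B = A)"

definition abs_mat :: "real mat \<Rightarrow> real mat" where
  "abs_mat S = psd_sqrt (S * S)"

definition vertex_seidel_energy :: "('a, 'b) pre_digraph \<Rightarrow> 'a list \<Rightarrow> nat \<Rightarrow> real" where
  "vertex_seidel_energy G vs i = abs_mat (seidel_matrix G vs) $$ (i, i)"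

end

(* With the sign vector e of the bipartition, S = e e^T - I, hence S^2 = (n-2) e e^T + I. The matrix
   I + ((n-2)/n) e e^T is positive semidefinite and has the same square, so it is |S|, and
   its diagonal entries are 1 + (n-2)/n. *)
theory Submission
  imports Defs
begin

lemma real_scalar_prod_self_nonneg: "0 \<le> (x :: real vec) \<bullet> x"
  unfolding scalar_prod_def by (intro sum_nonneg) simp

lemma real_scalar_prod_self_eq_0D:
  fixes x :: "real vec"
  assumes "x \<in> carrier_vec n" and "x \<bullet> x = 0"
  shows "x = 0\<^sub>v n"
proof (rule eq_vecI)
  have "\<forall>i\<in>{0..<n}. x $ i * x $ i = 0"
    using assms by (subst sum_nonneg_eq_0_iff[symmetric]) (auto simp: scalar_prod_def)
  then show "x $ i = 0\<^sub>v n $ i" if "i < dim_vec (0\<^sub>v n)" for i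
    using that by simp
qed (use assms in simp)

text \<open>Cyclicity of the trace, by exchanging the two summations. It is what lets a factor
  \<open>D\<close> move to the other side in \<open>psd_mat_square_inject\<close>.\<close>

lemma sum_diag_mult_comm:
  fixes A B :: "real mat"
  assumes "A \<in> carrier_mat n n" and "B \<in> carrier_mat n n"
  shows "(\<Sum>i<n. (A * B) $$ (i, i)) = (\<Sum>i<n. (B * A) $$ (i, i))"
proof -
  have "(\<Sum>i<n. (A * B) $$ (i, i)) = (\<Sum>i<n. \<Sum>k\<in>{0..<n}. A $$ (i, k) * B $$ (k, i))"
    using assms by (intro sum.cong refl) (simp add: scalar_prod_def)
  also have "\<dots> = (\<Sum>k\<in>{0..<n}. \<Sum>i<n. A $$ (i, k) * B $$ (k, i))"
    by (rule sum.swap)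
  also have "\<dots> = (\<Sum>k<n. \<Sum>i\<in>{0..<n}. B $$ (k, i) * A $$ (i, k))"
    by (simp add: atLeast0LessThan mult.commute)
  also have "\<dots> = (\<Sum>k<n. (B * A) $$ (k, k))"
    using assms by (intro sum.cong refl) (simp add: scalar_prod_def)
  finally show ?thesis .
qed

lemma symmetric_mat_scalar_prod:
  fixes A :: "real mat"
  assumes "A \<in> carrier_mat n n" and "transpose_mat A = A"
    and "x \<in> carrier_vec n" and "y \<in> carrier_vec n"
  shows "(A *\<^sub>v y) \<bullet> x = y \<bullet> (A *\<^sub>v x)"
  using transpose_vec_mult_scalar[OF assms(1,3,4)] assms(2) by simp

lemma psd_mat_form_nonneg:
  assumes "psd_mat A" and "A \<in> carrier_mat n n" and "x \<in> carrier_vec n"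
  shows "0 \<le> x \<bullet> (A *\<^sub>v x)"
  using assms unfolding psd_mat_def by auto

text \<open>A zero of a nonnegative form is a minimum. If \<open>A *\<^sub>v x\<close> were nonzero,
  a small move from \<open>x\<close> against this vector would make the form negative.\<close>

lemma psd_mat_form_eq_0D:
  assumes psd: "psd_mat A" and A: "A \<in> carrier_mat n n"
    and x: "x \<in> carrier_vec n" and zero: "x \<bullet> (A *\<^sub>v x) = 0"
  shows "A *\<^sub>v x = 0\<^sub>v n"
proof -
  define y where "y = A *\<^sub>v x"
  define m where "m = y \<bullet> y"
  define a where "a = y \<bullet> (A *\<^sub>v y)"
  \<comment> \<open>The form at \<open>x + t y\<close> is \<open>2 t m + t^2 a\<close>, with
    minimiser \<open>- m / a\<close>. The denominator \<open>a + 1\<close> also covers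
    \<open>a = 0\<close> and still gives a negative value unless \<open>m = 0\<close>.\<close>
  define t where "t = - m / (a + 1)"
  have y: "y \<in> carrier_vec n" and Ay: "A *\<^sub>v y \<in> carrier_vec n"
    using A x by (auto simp: y_def)
  have sym: "transpose_mat A = A"
    using psd by (simp add: psd_mat_def)
  have a: "0 \<le> a"
    unfolding a_def by (rule psd_mat_form_nonneg[OF psd A y])
  then have m: "m = - t * (a + 1)"
    by (simp add: t_def)
  have xAy: "x \<bullet> (A *\<^sub>v y) = m"
    using symmetric_mat_scalar_prod[OF A sym y x] by (simp add: m_def y_def)
  have "0 \<le> (x + t \<cdot>\<^sub>v y) \<bullet> (A *\<^sub>v (x + t \<cdot>\<^sub>v y))"
    using x y by (intro psd_mat_form_nonneg[OF psd A]) simp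
  also have "A *\<^sub>v (x + t \<cdot>\<^sub>v y) = y + t \<cdot>\<^sub>v (A *\<^sub>v y)"
    using x y mult_mat_vec[OF A y] by (simp add: mult_add_distrib_mat_vec[OF A] y_def)
  also have "(x + t \<cdot>\<^sub>v y) \<bullet> (y + t \<cdot>\<^sub>v (A *\<^sub>v y)) = 2 * t * m + t\<^sup>2 * a"
    using x y Ay zero xAy
    by (simp add: add_scalar_prod_distrib[of _ n] scalar_prod_add_distrib[of _ n]
        m_def a_def y_def[symmetric] power2_eq_square)
  also have "\<dots> = - (t\<^sup>2 * (a + 2))"
    unfolding m by (simp add: algebra_simps power2_eq_square)
  finally have "t\<^sup>2 * (a + 2) \<le> 0" by simp
  then have "t = 0"
    using a by (auto simp: mult_le_0_iff)
  then have "m = 0"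
    using m by simp
  then show ?thesis
    using real_scalar_prod_self_eq_0D[OF y] by (simp add: m_def y_def)
qed

text \<open>Uniqueness of the positive semidefinite root without diagonalisation. A trace identity
  forces \<open>B\<close> and \<open>C\<close>, hence also \<open>D = B - C\<close>, to annihilate
  every column of \<open>D\<close>; since \<open>D\<close> is symmetric, \<open>D * D = 0\<close>
  gives \<open>D = 0\<close>.\<close>

lemma psd_mat_square_inject:
  assumes psdB: "psd_mat B" and psdC: "psd_mat C"
    and B: "B \<in> carrier_mat n n" and C: "C \<in> carrier_mat n n"
    and eq: "B * B = C * C"
  shows "B = C"
proof -
  define D where "D = B - C"
  have D: "D \<in> carrier_mat n n"
    using minus_carrier_mat[OF C] by (simp add: D_def)
  have sym: "transpose_mat D = D"
    using psdB psdC B C by (simp add: D_def psd_mat_def transpose_minus)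
  have D_entry: "D $$ (i, j) = D $$ (j, i)" if "i < n" "j < n" for i j
    using arg_cong[OF sym, of "\<lambda>M. M $$ (i, j)"] D that by simp
  have row_D: "row D j = col D j" if "j < n" for j
    using that D D_entry by (intro eq_vecI) auto
  \<comment> \<open>Both sides equal \<open>C * C - B * C\<close> once \<open>B * B\<close> is
    replaced by \<open>C * C\<close>; \<open>B\<close> and \<open>C\<close> need not
    commute.\<close>
  have "B * D = - (D * C)"
    using B C eq by (intro eq_matI) (auto simp: D_def mult_minus_distrib_mat[of _ n n]
        minus_mult_distrib_mat[of _ n n])
  then have DBD: "D * (B * D) = - (D * (D * C))"
    using C D by simp
  \<comment> \<open>Hence \<open>D * B * D + D * C * D\<close> has trace zero; both summands are positive semidefinite.\<close>
  have form: "(D * (A * D)) $$ (j, j) = col D j \<bullet> (A *\<^sub>v col D j)"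
    if "j < n" "A \<in> carrier_mat n n" for A j
    using that D row_D[of j] by (simp add: col_mult2[of _ n n])
  have col: "col D j \<in> carrier_vec n" for j
    using D by auto
  have "(\<Sum>j<n. (D * (B * D)) $$ (j, j)) = - (\<Sum>j<n. (D * (D * C)) $$ (j, j))"
    using C D unfolding DBD by (simp add: sum_negf)
  also have "(\<Sum>j<n. (D * (D * C)) $$ (j, j)) = (\<Sum>j<n. (D * (C * D)) $$ (j, j))"
    using C D by (subst sum_diag_mult_comm[of _ n]) auto
  finally have sum0: "(\<Sum>j<n. col D j \<bullet> (B *\<^sub>v col D j) + col D j \<bullet> (C *\<^sub>v col D j)) = 0"
    using form B C by (simp add: sum.distrib)
  have nonneg: "0 \<le> col D j \<bullet> (B *\<^sub>v col D j)" "0 \<le> col D j \<bullet> (C *\<^sub>v col D j)" for j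
    using psd_mat_form_nonneg[OF psdB B col] psd_mat_form_nonneg[OF psdC C col] by auto
  have "col D j = 0\<^sub>v n" if j: "j < n" for j
  proof -
    have "col D j \<bullet> (B *\<^sub>v col D j) + col D j \<bullet> (C *\<^sub>v col D j) = 0"
      using sum0 j nonneg by (subst (asm) sum_nonneg_eq_0_iff) (auto intro: add_nonneg_nonneg)
    then have "col D j \<bullet> (B *\<^sub>v col D j) = 0" "col D j \<bullet> (C *\<^sub>v col D j) = 0"
      using nonneg[of j] by auto
    then have "B *\<^sub>v col D j = 0\<^sub>v n" "C *\<^sub>v col D j = 0\<^sub>v n"
      using psd_mat_form_eq_0D[OF psdB B col] psd_mat_form_eq_0D[OF psdC C col] by blast+
    then have "D *\<^sub>v col D j = 0\<^sub>v n"
      unfolding D_def using minus_mult_distrib_mat_vec[OF B C col[of j]] by (simp add: D_def)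
    \<comment> \<open>Entry \<open>j\<close> is row \<open>j\<close> of \<open>D\<close> times
      column \<open>j\<close>, that is, the squared norm of the column.\<close>
    then have "(D *\<^sub>v col D j) $ j = 0"
      using j by simp
    then have "col D j \<bullet> col D j = 0"
      using D j row_D[of j] by simp
    then show ?thesis
      by (rule real_scalar_prod_self_eq_0D[OF col])
  qed
  then have "D $$ (i, j) = 0" if "i < n" "j < n" for i j
    using that D by (metis carrier_matD index_col index_zero_vec(1))
  then show ?thesis
    using B C by (intro eq_matI) (auto simp: D_def)
qed

lemma psd_sqrt_eqI:
  assumes "psd_mat B" and "B \<in> carrier_mat n n" and "B * B = A"
  shows "psd_sqrt A = B"
proof -
  have "A \<in> carrier_mat n n"
    using assms by auto
  then show ?thesis
    unfolding psd_sqrt_def using assms psd_mat_square_inject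
    by (intro the_equality) auto
qed

text \<open>This is \<open>a I + c e e^T\<close>. For fixed \<open>e\<close> the family is closed
  under multiplication and contains both the Seidel matrix and its absolute value, so all matrix
  products reduce to arithmetic in \<open>a\<close> and \<open>c\<close>.\<close>

definition scalar_plus_dyad :: "nat \<Rightarrow> (nat \<Rightarrow> real) \<Rightarrow> real \<Rightarrow> real \<Rightarrow> real mat" where
  "scalar_plus_dyad n e a c = mat n n (\<lambda>(i, j). (if i = j then a else 0) + c * e i * e j)"

lemma scalar_plus_dyad_carrier: "scalar_plus_dyad n e a c \<in> carrier_mat n n"
  by (simp add: scalar_plus_dyad_def)

text \<open>The dyad satisfies \<open>(e e^T)^2 = q e e^T\<close>, where \<open>q\<close> is the
  squared norm of \<open>e\<close>.\<close>

lemma scalar_plus_dyad_mult: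
  assumes "(\<Sum>k<n. (e k)\<^sup>2) = q"
  shows "scalar_plus_dyad n e a c * scalar_plus_dyad n e b d =
    scalar_plus_dyad n e (a * b) (a * d + b * c + c * d * q)"
proof (rule eq_matI)
  fix i j
  assume "i < dim_row (scalar_plus_dyad n e (a * b) (a * d + b * c + c * d * q))"
    and "j < dim_col (scalar_plus_dyad n e (a * b) (a * d + b * c + c * d * q))"
  then have ij: "i < n" "j < n"
    by (auto simp: scalar_plus_dyad_def)
  have "(scalar_plus_dyad n e a c * scalar_plus_dyad n e b d) $$ (i, j) =
    (\<Sum>k<n. ((if i = k then a else 0) + c * e i * e k) * ((if k = j then b else 0) + d * e k * e j))"
    using ij by (simp add: scalar_plus_dyad_def scalar_prod_def atLeast0LessThan)
  \<comment> \<open>The product is expanded so that each conditional is a Kronecker delta in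
    \<open>k\<close>, which collapses the sum; only the last term needs \<open>q\<close>.\<close>
  also have "\<dots> = (\<Sum>k<n. (if i = k then (if k = j then a * b else 0) + a * d * e k * e j else 0)
      + (if k = j then b * c * e i * e k else 0) + c * d * e i * e j * (e k)\<^sup>2)"
    by (intro sum.cong refl) (simp add: algebra_simps power2_eq_square)
  also have "\<dots> = (if i = j then a * b else 0) + a * d * e i * e j + b * c * e i * e j
      + c * d * e i * e j * q"
    using ij by (simp add: sum.distrib sum_distrib_left[symmetric] assms)
  finally show "(scalar_plus_dyad n e a c * scalar_plus_dyad n e b d) $$ (i, j) =
      scalar_plus_dyad n e (a * b) (a * d + b * c + c * d * q) $$ (i, j)"
    using ij by (simp add: scalar_plus_dyad_def algebra_simps)
qed (simp_all add: scalar_plus_dyad_def)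

text \<open>The form at \<open>x\<close> is \<open>a |x|^2 + c p^2\<close>, where \<open>p\<close>
  is the inner product of \<open>e\<close> and \<open>x\<close>.\<close>

lemma psd_scalar_plus_dyad:
  assumes "0 \<le> a" and "0 \<le> c"
  shows "psd_mat (scalar_plus_dyad n e a c)"
  unfolding psd_mat_def
proof (intro conjI ballI)
  show "square_mat (scalar_plus_dyad n e a c)"
    by (simp add: scalar_plus_dyad_def)
  show "transpose_mat (scalar_plus_dyad n e a c) = scalar_plus_dyad n e a c"
    by (intro eq_matI) (auto simp: scalar_plus_dyad_def)
next
  fix x :: "real vec"
  assume "x \<in> carrier_vec (dim_row (scalar_plus_dyad n e a c))"
  then have x: "dim_vec x = n"
    by (simp add: scalar_plus_dyad_def)
  define p where "p = (\<Sum>j<n. e j * x $ j)"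
  have entry: "(scalar_plus_dyad n e a c *\<^sub>v x) $ i = a * x $ i + c * e i * p" if "i < n" for i
  proof -
    have "(scalar_plus_dyad n e a c *\<^sub>v x) $ i =
        (\<Sum>j<n. ((if i = j then a else 0) + c * e i * e j) * x $ j)"
      using that x by (simp add: scalar_plus_dyad_def scalar_prod_def atLeast0LessThan)
    also have "\<dots> = (\<Sum>j<n. (if i = j then a * x $ j else 0) + c * e i * (e j * x $ j))"
      by (intro sum.cong refl) (simp add: algebra_simps)
    also have "\<dots> = a * x $ i + c * e i * p"
      using that by (simp add: sum.distrib sum_distrib_left[symmetric] p_def)
    finally show ?thesis .
  qed
  have "x \<bullet> (scalar_plus_dyad n e a c *\<^sub>v x) =
      (\<Sum>i<n. x $ i * (scalar_plus_dyad n e a c *\<^sub>v x) $ i)"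
    by (simp add: scalar_prod_def atLeast0LessThan scalar_plus_dyad_def)
  also have "\<dots> = (\<Sum>i<n. a * (x $ i)\<^sup>2 + c * p * (e i * x $ i))"
    by (intro sum.cong refl) (simp add: entry algebra_simps power2_eq_square)
  also have "\<dots> = a * (\<Sum>i<n. (x $ i)\<^sup>2) + c * p\<^sup>2"
    by (simp add: sum.distrib sum_distrib_left[symmetric] p_def power2_eq_square)
  finally show "0 \<le> x \<bullet> (scalar_plus_dyad n e a c *\<^sub>v x)"
    using assms by (simp add: sum_nonneg)
qed

text \<open>The matrix \<open>e e^T - I\<close> has eigenvalue \<open>n - 1\<close> on
  \<open>e\<close> and \<open>-1\<close> on its orthogonal complement. Turning \<open>-1\<close>
  into \<open>1\<close> while keeping \<open>n - 1\<close> requires \<open>1 + c n = n - 1\<close>,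
  whence the coefficient; \<open>2 \<le> n\<close> makes it nonnegative.\<close>

lemma abs_mat_dyad_minus_one:
  assumes sq: "\<And>k. k < n \<Longrightarrow> (e k)\<^sup>2 = 1" and n: "2 \<le> n"
  shows "abs_mat (scalar_plus_dyad n e (- 1) 1) = scalar_plus_dyad n e 1 ((real n - 2) / real n)"
proof -
  define c where "c = (real n - 2) / real n"
  have q: "(\<Sum>k<n. (e k)\<^sup>2) = real n"
    using sq by simp
  \<comment> \<open>These are the coefficients of \<open>e e^T\<close> in the two squares; the
    coefficient of \<open>I\<close> is 1 in both.\<close>
  have "2 * c + c * c * real n = real n - 2"
    using n by (simp add: c_def field_simps)
  then have "scalar_plus_dyad n e 1 c * scalar_plus_dyad n e 1 c =
      scalar_plus_dyad n e (- 1) 1 * scalar_plus_dyad n e (- 1) 1"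
    by (simp add: scalar_plus_dyad_mult[OF q])
  moreover have "psd_mat (scalar_plus_dyad n e 1 c)"
    using n by (intro psd_scalar_plus_dyad) (auto simp: c_def)
  ultimately show ?thesis
    unfolding abs_mat_def c_def[symmetric]
    by (intro psd_sqrt_eqI[OF _ scalar_plus_dyad_carrier])
qed

text \<open>The product of two signs is 1 within a part and -1 across the parts, exactly the
  off-diagonal Seidel entries; subtracting \<open>I\<close> clears the diagonal.\<close>

lemma seidel_matrix_complete_bipartite:
  assumes vs: "distinct vs" "set vs = U \<union> V" and disj: "U \<inter> V = {}"
    and arcs: "arcs_ends G = U \<times> V \<union> V \<times> U"
  shows "seidel_matrix G vs =
    scalar_plus_dyad (length vs) (\<lambda>i. if vs ! i \<in> U then 1 else - 1) (- 1) 1"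
proof (rule eq_matI)
  fix i j
  assume "i < dim_row (scalar_plus_dyad (length vs) (\<lambda>i. if vs ! i \<in> U then 1 else - 1) (- 1) 1)"
    and "j < dim_col (scalar_plus_dyad (length vs) (\<lambda>i. if vs ! i \<in> U then 1 else - 1) (- 1) 1)"
  then have ij: "i < length vs" "j < length vs"
    by (auto simp: scalar_plus_dyad_def)
  then have "vs ! i \<in> U \<union> V" "vs ! j \<in> U \<union> V"
    using vs(2) nth_mem by blast+
  then show "seidel_matrix G vs $$ (i, j) =
      scalar_plus_dyad (length vs) (\<lambda>i. if vs ! i \<in> U then 1 else - 1) (- 1) 1 $$ (i, j)"
    using ij disj by (auto simp: seidel_matrix_def scalar_plus_dyad_def arcs)
qed (simp_all add: seidel_matrix_def scalar_plus_dyad_def)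

theorem mainTheorem3:
  fixes r s :: nat and G :: "('a, 'b) pre_digraph" and vs :: "'a list"
  assumes "r \<ge> 1" and "s \<ge> 1"
    and "K\<^bsub>r,s\<^esub> G"
    and "vertex_enumeration G vs"
  shows "\<forall>i < length vs. vertex_seidel_energy G vs i = 2 * (real r + real s - 1) / (real r + real s)"
proof -
  obtain U V where UV: "verts G = U \<union> V" "U \<inter> V = {}" "card U = r" "card V = s"
    "arcs_ends G = U \<times> V \<union> V \<times> U"
    using assms(3) unfolding complete_bipartite_digraph_def by blast
  have vs: "distinct vs" "set vs = U \<union> V"
    using assms(4) UV(1) by (auto simp: vertex_enumeration_def)
  have "finite (U \<union> V)"
    by (simp flip: vs(2))
  then have n: "length vs = r + s"
    using distinct_card[OF vs(1)] vs(2) UV(2-4) by (simp add: card_Un_disjoint)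
  define e :: "nat \<Rightarrow> real" where "e i = (if vs ! i \<in> U then 1 else - 1)" for i
  have sq: "(e k)\<^sup>2 = 1" for k
    by (simp add: e_def)
  have "seidel_matrix G vs = scalar_plus_dyad (r + s) e (- 1) 1"
    using seidel_matrix_complete_bipartite[OF vs UV(2,5)] by (simp add: n e_def[abs_def])
  \<comment> \<open>Both parts are nonempty, so \<open>r + s\<close> is at least 2, as
    \<open>abs_mat_dyad_minus_one\<close> requires.\<close>
  then have energy: "vertex_seidel_energy G vs i =
      scalar_plus_dyad (r + s) e 1 ((real (r + s) - 2) / real (r + s)) $$ (i, i)" for i
    unfolding vertex_seidel_energy_def using abs_mat_dyad_minus_one[of "r + s" e] sq assms(1,2)
    by simp
  show ?thesis
  proof (intro allI impI)
    fix i assume "i < length vs"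
    then have "vertex_seidel_energy G vs i = 1 + (real (r + s) - 2) / real (r + s) * (e i)\<^sup>2"
      unfolding energy by (simp add: n scalar_plus_dyad_def power2_eq_square)
    \<comment> \<open>The sign of a vertex enters only through its square, so both parts give the
      same value.\<close>
    also have "\<dots> = 2 * (real r + real s - 1) / (real r + real s)"
      using assms(1) unfolding sq by (simp add: field_simps)
    finally show "vertex_seidel_energy G vs i = 2 * (real r + real s - 1) / (real r + real s)" .
  qed
qed

end
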